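(* The function $$h(x)=\frac{\ln\frac{x}{\sin x}}{\ln\frac{\sinh x}{x}},\qquad x\in\left(0,\frac{\pi}{2}\right),$$ is strictly increasing. As a corollary, the best constants (the greatest $p>0$ and the least $q>0$) such that $$\left(\frac{\sinh x}{x}\right)^p<\frac{x}{\sin x}<\left(\frac{\sinh x}{x}\right)^q\qquad\text{for all } x\in\left(0,\frac{\pi}{2}\right)$$ are $p=1$ and $q=\frac{\ln(\pi/2)}{\ln\left(\frac{\sinh(\pi/2)}{\pi/2}\right)}$ (approximately $1.18$). *)

theory Defs
  imports "HOL-Analysis.Analysis"
begin

definition h :: "real \<Rightarrow> real" where
  "h x = ln (x / sin x) / ln (sinh x / x)"

definition lower_exponents :: "real set" where
  "lower_exponents =
     {p. p > 0 \<and> (\<forall>x\<in>{0<..<pi/2}. (sinh x / x) powr p < x / sin x)}"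

definition upper_exponents :: "real set" where
  "upper_exponents =
     {q. q > 0 \<and> (\<forall>x\<in>{0<..<pi/2}. x / sin x < (sinh x / x) powr q)}"

definition is_greatest :: "real set \<Rightarrow> real \<Rightarrow> bool" where
  "is_greatest S m \<longleftrightarrow> m \<in> S \<and> (\<forall>s\<in>S. s \<le> m)"

definition is_least :: "real set \<Rightarrow> real \<Rightarrow> bool" where
  "is_least S m \<longleftrightarrow> m \<in> S \<and> (\<forall>s\<in>S. m \<le> s)"

end

theory Submission
  imports Defs "HOL-Real_Asymp.Real_Asymp"
begin

text \<open>
  Write h = f / g with f x = ln (x / sin x) and g x = ln (sinh x / x); both vanish at 0. By the
  monotone form of l'Hospital's rule it suffices that f' / g' increases. After dividing numerator
  and denominator by x, the former, (1/x - cot x) / x, increases and the latter,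
  (coth x - 1/x) / x, decreases; both signs reduce to elementary inequalities obtained by
  differentiating repeatedly. The best constants are the one-sided limits of h at 0 and at pi/2,
  because (sinh x / x)^p < x / sin x means p < h x.
\<close>

section \<open>Positivity from derivatives, the monotone l'Hospital rule, strict bounds by
  limits\<close>

text \<open>\<open>\<phi>\<close> increases strictly, so near \<open>a\<close> it stays below its
  value at the midpoint \<open>m\<close>; the limit gives \<open>0 \<le> \<phi> m\<close>, and
  \<open>\<phi> m < \<phi> x\<close> makes this strict. Only a limit at \<open>a\<close> is assumed,
  which covers quotients whose formula degenerates there.\<close>

lemma pos_if_deriv_pos_at_right:
  fixes \<phi> \<phi>' :: "real \<Rightarrow> real"
  assumes lim: "(\<phi> \<longlongrightarrow> 0) (at_right a)"
    and der: "\<And>x. a < x \<Longrightarrow> x < b \<Longrightarrow> (\<phi> has_real_derivative \<phi>' x) (at x)"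
    and pos: "\<And>x. a < x \<Longrightarrow> x < b \<Longrightarrow> \<phi>' x > 0"
    and x: "a < x" "x < b"
  shows "\<phi> x > 0"
proof -
  have less: "\<phi> u < \<phi> v" if "a < u" "u < v" "v < b" for u v
    using that by (intro DERIV_pos_imp_increasing[of u v \<phi>]) (auto intro!: exI der pos)
  define m where "m = (a + x) / 2"
  have m: "a < m" "m < x"
    using x by (auto simp: m_def)
  have "eventually (\<lambda>u. u \<in> {a<..<m}) (at_right a)"
    using m by (intro eventually_at_right_real) auto
  hence "eventually (\<lambda>u. \<phi> u \<le> \<phi> m) (at_right a)"
    by eventually_elim (use less m x in \<open>auto intro!: less_imp_le\<close>)
  hence "0 \<le> \<phi> m"
    by (intro tendsto_upperbound[OF lim]) auto
  also have "\<phi> m < \<phi> x"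
    using less m x by auto
  finally show ?thesis .
qed

text \<open>The sign of the derivative of \<open>f / g\<close> is that of
  \<open>f' g - f g'\<close>. Freezing the ratio \<open>?r\<close> at \<open>x\<close>, the function
  \<open>?r * g t - f t\<close> tends to 0 at \<open>a\<close> and increases for
  \<open>t < x\<close>, hence is positive at \<open>x\<close>; multiplying by \<open>g' x\<close>
  gives the claim.\<close>

lemma monotone_lhopital:
  fixes f g f' g' :: "real \<Rightarrow> real"
  assumes f0: "(f \<longlongrightarrow> 0) (at_right a)" and g0: "(g \<longlongrightarrow> 0) (at_right a)"
    and df: "\<And>x. a < x \<Longrightarrow> x < b \<Longrightarrow> (f has_real_derivative f' x) (at x)"
    and dg: "\<And>x. a < x \<Longrightarrow> x < b \<Longrightarrow> (g has_real_derivative g' x) (at x)"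
    and g'_pos: "\<And>x. a < x \<Longrightarrow> x < b \<Longrightarrow> g' x > 0"
    and mono: "strict_mono_on {a<..<b} (\<lambda>x. f' x / g' x)"
  shows "strict_mono_on {a<..<b} (\<lambda>x. f x / g x)"
proof -
  have g_pos: "g x > 0" if "a < x" "x < b" for x
    using pos_if_deriv_pos_at_right[OF g0 dg g'_pos] that by blast
  have num: "f' x * g x - f x * g' x > 0" if x: "a < x" "x < b" for x
  proof -
    let ?r = "f' x / g' x"
    define \<phi> where "\<phi> t = ?r * g t - f t" for t
    have d\<phi>: "(\<phi> has_real_derivative ?r * g' t - f' t) (at t)" if "a < t" "t < b" for t
      unfolding \<phi>_def using that by (intro DERIV_diff DERIV_cmult df dg)
    have \<phi>'_pos: "?r * g' t - f' t > 0" if "a < t" "t < x" for t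
    proof -
      have "f' t / g' t < ?r"
        using strict_mono_onD[OF mono, of t x] that x by auto
      thus ?thesis
        using g'_pos[of t] that x by (simp add: divide_less_eq)
    qed
    \<comment> \<open>The derivative of \<open>\<phi>\<close> vanishes at \<open>x\<close> itself,
      so positivity is first obtained at \<open>m < x\<close> and then carried to \<open>x\<close>
      by monotonicity on \<open>{m..x}\<close>.\<close>
    define m where "m = (a + x) / 2"
    have m: "a < m" "m < x"
      using x by (auto simp: m_def)
    have "(\<phi> \<longlongrightarrow> 0) (at_right a)"
      unfolding \<phi>_def using tendsto_diff[OF tendsto_mult_left[OF g0, of ?r] f0] by simp
    hence "0 < \<phi> m"
      by (rule pos_if_deriv_pos_at_right) (use m x in \<open>auto intro!: d\<phi> \<phi>'_pos simp del: times_divide_eq_left\<close>)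
    also have "\<phi> m < \<phi> x"
    proof (rule DERIV_pos_imp_increasing_open[OF m(2)])
      show "continuous_on {m..x} \<phi>"
        using m x by (intro DERIV_atLeastAtMost_imp_continuous_on) (auto intro!: exI d\<phi>)
    qed (use m x in \<open>auto intro!: exI d\<phi> \<phi>'_pos\<close>)
    finally have "?r * g x - f x > 0"
      by (simp add: \<phi>_def)
    thus ?thesis
      using g'_pos[OF x] by (simp add: field_simps)
  qed
  show ?thesis
  proof (rule strict_mono_onI)
    fix u v assume uv: "u \<in> {a<..<b}" "v \<in> {a<..<b}" "u < v"
    show "f u / g u < f v / g v"
    proof (rule DERIV_pos_imp_increasing[OF uv(3)], intro exI conjI)
      fix x assume "u \<le> x" "x \<le> v"
      hence x: "a < x" "x < b"
        using uv by auto
      show "((\<lambda>x. f x / g x) has_real_derivative (f' x * g x - f x * g' x) / (g x * g x)) (at x)"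
        using g_pos[OF x] by (intro DERIV_divide df dg x) auto
      show "(f' x * g x - f x * g' x) / (g x * g x) > 0"
        using num[OF x] g_pos[OF x] by simp
    qed
  qed
qed

lemma strict_mono_on_gt_limit_at_right:
  fixes f :: "real \<Rightarrow> real"
  assumes "strict_mono_on {a<..<b} f" and lim: "(f \<longlongrightarrow> L) (at_right a)" and x: "a < x" "x < b"
  shows "L < f x"
proof -
  define m where "m = (a + x) / 2"
  have m: "a < m" "m < x"
    using x by (auto simp: m_def)
  have "eventually (\<lambda>u. u \<in> {a<..<m}) (at_right a)"
    using m by (intro eventually_at_right_real) auto
  hence "eventually (\<lambda>u. f u \<le> f m) (at_right a)"
    by eventually_elim (use m x in \<open>auto intro!: less_imp_le strict_mono_onD[OF assms(1)]\<close>)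
  hence "L \<le> f m"
    by (intro tendsto_upperbound[OF lim]) auto
  also have "f m < f x"
    using m x by (auto intro!: strict_mono_onD[OF assms(1)])
  finally show ?thesis .
qed

lemma strict_mono_on_less_limit_at_left:
  fixes f :: "real \<Rightarrow> real"
  assumes "strict_mono_on {a<..<b} f" and lim: "(f \<longlongrightarrow> L) (at_left b)" and x: "a < x" "x < b"
  shows "f x < L"
proof -
  define m where "m = (x + b) / 2"
  have m: "x < m" "m < b"
    using x by (auto simp: m_def)
  have "f x < f m"
    using m x by (auto intro!: strict_mono_onD[OF assms(1)])
  also have "eventually (\<lambda>u. u \<in> {m<..<b}) (at_left b)"
    using m by (intro eventually_at_left_real) auto
  hence "eventually (\<lambda>u. f u \<ge> f m) (at_left b)"
    by eventually_elim (use m x in \<open>auto intro!: less_imp_le strict_mono_onD[OF assms(1)]\<close>)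
  hence "f m \<le> L"
    by (intro tendsto_lowerbound[OF lim]) auto
  finally show ?thesis .
qed

section \<open>Trigonometric inequalities\<close>

text \<open>First rung of a ladder: here the difference has derivative \<open>x * sin x\<close>, and
  each of the next three expressions vanishes at 0 and has the previous one as its
  derivative.\<close>

lemma x_cos_less_sin:
  fixes x :: real
  assumes "0 < x" "x < pi"
  shows "x * cos x < sin x"
proof -
  have "sin x - x * cos x > 0"
    by (rule pos_if_deriv_pos_at_right[where a = 0 and b = pi and \<phi>' = "\<lambda>x. x * sin x"])
       (use assms in \<open>auto intro!: derivative_eq_intros tendsto_eq_intros mult_pos_pos sin_gt_zero\<close>)
  thus ?thesis by simp
qed

lemma x_sin_less_two_minus_two_cos:
  fixes x :: real
  assumes "0 < x" "x < pi"
  shows "2 - 2 * cos x - x * sin x > 0"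
  by (rule pos_if_deriv_pos_at_right[where a = 0 and b = pi and \<phi>' = "\<lambda>x. sin x - x * cos x"])
     (use assms in \<open>auto intro!: derivative_eq_intros tendsto_eq_intros simp: x_cos_less_sin\<close>)

lemma cusa_inequality:
  fixes x :: real
  assumes "0 < x" "x < pi"
  shows "2 * x + x * cos x - 3 * sin x > 0"
  by (rule pos_if_deriv_pos_at_right[where a = 0 and b = pi and \<phi>' = "\<lambda>x. 2 - 2 * cos x - x * sin x"])
     (use assms x_sin_less_two_minus_two_cos in \<open>auto intro!: derivative_eq_intros tendsto_eq_intros simp: algebra_simps\<close>)

lemma four_less_x_sin_plus_four_cos:
  fixes x :: real
  assumes "0 < x" "x < pi"
  shows "x\<^sup>2 + x * sin x + 4 * cos x - 4 > 0"
  by (rule pos_if_deriv_pos_at_right[where a = 0 and b = pi and \<phi>' = "\<lambda>x. 2 * x + x * cos x - 3 * sin x"])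
     (use assms cusa_inequality in \<open>auto intro!: derivative_eq_intros tendsto_eq_intros simp: algebra_simps\<close>)

text \<open>The last rung at \<open>2 * x\<close> is four times the difference of the two sides, by
  the double-angle formulas; the doubling halves the interval to \<open>pi / 2\<close>.\<close>

lemma two_sin_squared_less:
  fixes x :: real
  assumes "0 < x" "x < pi / 2"
  shows "2 * (sin x)\<^sup>2 < x\<^sup>2 + x * sin x * cos x"
  using four_less_x_sin_plus_four_cos[of "2 * x"] assms
  by (simp add: sin_double cos_double_sin power_mult_distrib)

section \<open>Hyperbolic inequalities\<close>

text \<open>Start of the analogous ladder for \<open>sinh\<close> and \<open>cosh\<close>. It works
  on the whole half-line, so \<open>x + 1\<close> serves merely as some right endpoint beyond
  \<open>x\<close>.\<close>

lemma sinh_less_x_cosh: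
  fixes x :: real
  assumes "0 < x"
  shows "sinh x < x * cosh x"
proof -
  have "x * cosh x - sinh x > 0"
    by (rule pos_if_deriv_pos_at_right[where a = 0 and b = "x + 1" and \<phi>' = "\<lambda>x. x * sinh x"])
       (use assms in \<open>auto intro!: derivative_eq_intros tendsto_eq_intros mult_pos_pos\<close>)
  thus ?thesis by simp
qed

lemma two_cosh_minus_two_less_x_sinh:
  fixes x :: real
  assumes "0 < x"
  shows "2 - 2 * cosh x + x * sinh x > 0"
  by (rule pos_if_deriv_pos_at_right[where a = 0 and b = "x + 1" and \<phi>' = "\<lambda>x. x * cosh x - sinh x"])
     (use assms in \<open>auto intro!: derivative_eq_intros tendsto_eq_intros simp: sinh_less_x_cosh\<close>)

lemma cusa_inequality_hyperbolic:
  fixes x :: real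
  assumes "0 < x"
  shows "2 * x + x * cosh x - 3 * sinh x > 0"
  by (rule pos_if_deriv_pos_at_right[where a = 0 and b = "x + 1" and \<phi>' = "\<lambda>x. 2 - 2 * cosh x + x * sinh x"])
     (use assms two_cosh_minus_two_less_x_sinh in \<open>auto intro!: derivative_eq_intros tendsto_eq_intros simp: algebra_simps\<close>)

lemma four_cosh_minus_four_less:
  fixes x :: real
  assumes "0 < x"
  shows "x\<^sup>2 + x * sinh x - 4 * cosh x + 4 > 0"
  by (rule pos_if_deriv_pos_at_right[where a = 0 and b = "x + 1" and \<phi>' = "\<lambda>x. 2 * x + x * cosh x - 3 * sinh x"])
     (use assms cusa_inequality_hyperbolic in \<open>auto intro!: derivative_eq_intros tendsto_eq_intros simp: algebra_simps\<close>)

lemma two_sinh_squared_less: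
  fixes x :: real
  assumes "0 < x"
  shows "2 * (sinh x)\<^sup>2 < x\<^sup>2 + x * sinh x * cosh x"
proof -
  have "cosh (2 * x) = 1 + 2 * (sinh x)\<^sup>2"
    by (simp add: cosh_double cosh_square_eq)
  thus ?thesis
    using four_cosh_minus_four_less[of "2 * x"] assms by (simp add: sinh_double power_mult_distrib)
qed

section \<open>Derivatives of the two logarithms and their monotonicity after division by x\<close>

lemma ln_sin_quotient_deriv:
  assumes "0 < x" "x < pi"
  shows "((\<lambda>x::real. ln (x / sin x)) has_real_derivative 1 / x - cos x / sin x) (at x)"
  using assms sin_gt_zero[of x]
  by (auto intro!: derivative_eq_intros simp: field_simps power2_eq_square)

lemma ln_sinh_quotient_deriv:
  assumes "0 < x"
  shows "((\<lambda>x::real. ln (sinh x / x)) has_real_derivative cosh x / sinh x - 1 / x) (at x)"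
  using assms sinh_real_pos_iff[of x]
  by (auto intro!: derivative_eq_intros simp: field_simps power2_eq_square)

lemma coth_minus_inverse_pos:
  assumes "0 < x"
  shows "cosh x / sinh x - 1 / x > (0::real)"
  using sinh_less_x_cosh[OF assms] assms by (simp add: field_simps)

text \<open>The numerator of the derivative is exactly the difference in
  \<open>two_sin_squared_less\<close>.\<close>

lemma inverse_minus_cot_over_x_mono:
  "strict_mono_on {0<..<pi/2} (\<lambda>x. (1 / x - cos x / sin x) / x)"
proof (rule strict_mono_onI)
  fix u v :: real assume uv: "u \<in> {0<..<pi/2}" "v \<in> {0<..<pi/2}" "u < v"
  show "(1 / u - cos u / sin u) / u < (1 / v - cos v / sin v) / v"
  proof (rule DERIV_pos_imp_increasing[OF uv(3)], intro exI conjI)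
    fix x assume "u \<le> x" "x \<le> v"
    hence x: "0 < x" "x < pi / 2"
      using uv by auto
    have s: "sin x > 0"
      using x by (intro sin_gt_zero) auto
    have e: "((- 1 / x\<^sup>2 + 1 / (sin x)\<^sup>2) * x - (1 / x - cos x / sin x)) / x\<^sup>2 =
        (x\<^sup>2 + x * sin x * cos x - 2 * (sin x)\<^sup>2) / (x ^ 3 * (sin x)\<^sup>2)"
      using x s by (simp add: field_simps power2_eq_square power3_eq_cube)
    \<comment> \<open>Passing through \<open>cot\<close> gives the derivative with
      \<open>1 / (sin x)\<^sup>2\<close> directly, with no Pythagorean simplification.\<close>
    have "((\<lambda>x. 1 / x - cot x) has_real_derivative (- 1 / x\<^sup>2 + 1 / (sin x)\<^sup>2)) (at x)"
      using x s by (auto intro!: derivative_eq_intros DERIV_cot simp: power2_eq_square inverse_eq_divide)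
    hence "((\<lambda>x. 1 / x - cos x / sin x) has_real_derivative (- 1 / x\<^sup>2 + 1 / (sin x)\<^sup>2)) (at x)"
      by (simp add: cot_def)
    from DERIV_divide[OF this DERIV_ident] x e
    show "((\<lambda>x. (1 / x - cos x / sin x) / x) has_real_derivative
        (x\<^sup>2 + x * sin x * cos x - 2 * (sin x)\<^sup>2) / (x ^ 3 * (sin x)\<^sup>2)) (at x)"
      by (simp add: power2_eq_square)
    show "(x\<^sup>2 + x * sin x * cos x - 2 * (sin x)\<^sup>2) / (x ^ 3 * (sin x)\<^sup>2) > 0"
      using two_sin_squared_less[OF x] x s by simp
  qed
qed

text \<open>The derivative of \<open>coth\<close> is negative where that of \<open>- cot\<close> is
  positive, so here the analogous numerator, from \<open>two_sinh_squared_less\<close>, enters with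
  a minus sign.\<close>

lemma coth_minus_inverse_over_x_antimono:
  assumes uv: "0 < u" "u < v"
  shows "(cosh v / sinh v - 1 / v) / v < (cosh u / sinh u - 1 / u) / (u::real)"
proof (rule DERIV_neg_imp_decreasing[OF uv(2)], intro exI conjI)
  fix x assume "u \<le> x" "x \<le> v"
  hence x: "0 < x"
    using uv by auto
  hence s: "sinh x > 0"
    by simp
  have c: "(sinh x * sinh x - cosh x * cosh x) / (sinh x * sinh x) = - 1 / (sinh x)\<^sup>2"
    using cosh_square_eq[of x] by (simp add: power2_eq_square)
  have e: "((- 1 / (sinh x)\<^sup>2 + 1 / x\<^sup>2) * x - (cosh x / sinh x - 1 / x)) / x\<^sup>2 =
      - (x\<^sup>2 + x * sinh x * cosh x - 2 * (sinh x)\<^sup>2) / (x ^ 3 * (sinh x)\<^sup>2)"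
    using x s by (simp add: field_simps power2_eq_square power3_eq_cube)
  have "((\<lambda>x. cosh x / sinh x - 1 / x) has_real_derivative (- 1 / (sinh x)\<^sup>2 + 1 / x\<^sup>2)) (at x)"
    using x by (auto intro!: derivative_eq_intros simp: c) (simp add: power2_eq_square)
  from DERIV_divide[OF this DERIV_ident] x e
  show "((\<lambda>x. (cosh x / sinh x - 1 / x) / x) has_real_derivative
      - (x\<^sup>2 + x * sinh x * cosh x - 2 * (sinh x)\<^sup>2) / (x ^ 3 * (sinh x)\<^sup>2)) (at x)"
    by (simp add: power2_eq_square)
  show "- (x\<^sup>2 + x * sinh x * cosh x - 2 * (sinh x)\<^sup>2) / (x ^ 3 * (sinh x)\<^sup>2) < 0"
    using two_sinh_squared_less[OF x] x s by (simp add: divide_neg_pos)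
qed

section \<open>Monotonicity of h and its boundary limits\<close>

lemma h_strict_mono: "strict_mono_on {0<..<pi/2} h"
  unfolding h_def[abs_def]
proof (rule monotone_lhopital)
  show "((\<lambda>x::real. ln (x / sin x)) \<longlongrightarrow> 0) (at_right 0)"
    by real_asymp
  show "((\<lambda>x::real. ln (sinh x / x)) \<longlongrightarrow> 0) (at_right 0)"
    by real_asymp
  show "strict_mono_on {0<..<pi/2}
      (\<lambda>x. (1 / x - cos x / sin x) / (cosh x / sinh x - 1 / x))"
  proof (rule strict_mono_onI)
    fix u v :: real assume uv: "u \<in> {0<..<pi/2}" "v \<in> {0<..<pi/2}" "u < v"
    \<comment> \<open>Undivided, \<open>cosh x / sinh x - 1 / x\<close> increases too, which leaves
      the quotient undecided. Dividing by \<open>x\<close> keeps the ratio and makes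
      \<open>?B\<close> decrease.\<close>
    let ?A = "\<lambda>x::real. (1 / x - cos x / sin x) / x"
    let ?B = "\<lambda>x::real. (cosh x / sinh x - 1 / x) / x"
    have "?A u > 0"
      using uv x_cos_less_sin[of u] sin_gt_zero[of u] by (auto simp: field_simps)
    moreover have "?A u < ?A v"
      using strict_mono_onD[OF inverse_minus_cot_over_x_mono] uv by blast
    moreover have "?B v < ?B u"
      using coth_minus_inverse_over_x_antimono[of u v] uv by simp
    moreover have "?B v > 0"
      using coth_minus_inverse_pos[of v] uv by simp
    ultimately have "?A u / ?B u < ?A v / ?B v"
      by (intro frac_less2[of "?A u" "?A v" "?B v" "?B u"]) auto
    thus "(1 / u - cos u / sin u) / (cosh u / sinh u - 1 / u) <
        (1 / v - cos v / sin v) / (cosh v / sinh v - 1 / v)"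
      using uv by simp
  qed
qed (auto intro!: ln_sin_quotient_deriv ln_sinh_quotient_deriv simp: coth_minus_inverse_pos[simplified])

text \<open>Both logarithms behave like \<open>x^2 / 6\<close> near 0.\<close>

lemma h_tendsto_one: "(h \<longlongrightarrow> 1) (at_right 0)"
  unfolding h_def[abs_def] by real_asymp

lemma ln_sinh_quotient_pos:
  assumes "0 < x"
  shows "ln (sinh x / x) > (0::real)"
  by (rule pos_if_deriv_pos_at_right[where a = 0 and b = "x + 1" and \<phi>' = "\<lambda>x. cosh x / sinh x - 1 / x"])
     (use assms in \<open>auto intro!: ln_sinh_quotient_deriv simp: coth_minus_inverse_pos[simplified]\<close>, real_asymp)

text \<open>At \<open>pi / 2\<close> nothing degenerates: \<open>sin\<close> is 1 and the
  denominator of \<open>h\<close> is positive, so the limit is the value.\<close>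

lemma h_tendsto_pi_half: "(h \<longlongrightarrow> h (pi / 2)) (at_left (pi / 2))"
proof -
  have "isCont h (pi / 2)"
    unfolding h_def[abs_def] using ln_sinh_quotient_pos[of "pi / 2"]
    by (auto intro!: continuous_intros isCont_ln)
  thus ?thesis
    using continuous_at_imp_continuous_at_within continuous_within by blast
qed

lemma powr_sinh_quotient_compare:
  assumes "0 < x" "x < pi / 2"
  shows "(sinh x / x) powr p < x / sin x \<longleftrightarrow> p < h x"
    and "x / sin x < (sinh x / x) powr p \<longleftrightarrow> h x < p"
proof -
  have s: "x / sin x > 0" "sinh x / x > 0"
    using assms sin_gt_zero[of x] by auto
  have eq: "(sinh x / x) powr p = exp (p * ln (sinh x / x))" "x / sin x = exp (ln (x / sin x))"
    using assms s by (simp_all add: powr_def)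
  show "(sinh x / x) powr p < x / sin x \<longleftrightarrow> p < h x"
    using ln_sinh_quotient_pos[of x] assms unfolding eq(1) by (subst eq(2)) (simp add: h_def less_divide_eq)
  show "x / sin x < (sinh x / x) powr p \<longleftrightarrow> h x < p"
    using ln_sinh_quotient_pos[of x] assms unfolding eq(1) by (subst eq(2)) (simp add: h_def divide_less_eq)
qed

section \<open>Numerical value of the upper constant\<close>

lemma h_pi_half_approx: "\<bar>ln (pi/2) / ln (sinh (pi/2) / (pi/2)) - 1.18\<bar> < (0.005 :: real)"
proof -
  have p: "1.57079 \<le> pi / 2" "pi / 2 \<le> 1.5708"
    using pi_approx by auto
  have f1: "ln (1.57079::real) \<ge> 0.45155" and f2: "ln (1.5708::real) \<le> 0.4516"
    using ln_approx_bounds[of "1.57079" 4] ln_approx_bounds[of "1.5708" 4]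
    by (simp_all add: eval_nat_numeral)
  \<comment> \<open>These logarithms enclose \<open>pi / 4\<close>, so 2.193 and 2.194 enclose
    \<open>exp (pi / 4)\<close>; squaring then encloses \<open>exp (pi / 2)\<close>.\<close>
  have e1: "ln (2.193::real) \<le> 0.785395" and e2: "ln (2.194::real) \<ge> 0.7854"
    using ln_approx_bounds[of "2.193" 4] ln_approx_bounds[of "2.194" 4]
    by (simp_all add: eval_nat_numeral)
  \<comment> \<open>1.4645 and 1.4667 will enclose \<open>sinh (pi / 2) / (pi / 2)\<close>.\<close>
  have g1: "ln (1.4645::real) \<ge> 0.3812" and g2: "ln (1.4667::real) \<le> 0.3832"
    using ln_approx_bounds[of "1.4645" 4] ln_approx_bounds[of "1.4667" 4]
    by (simp_all add: eval_nat_numeral)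
  have "(2.193::real) \<le> exp (pi / 4)" "exp (pi / 4) \<le> (2.194::real)"
    using e1 e2 p ln_le_cancel_iff[of "2.193" "exp (pi / 4)"] ln_le_cancel_iff[of "exp (pi / 4)" "2.194"]
    unfolding ln_exp by simp_all
  hence "(2.193::real)\<^sup>2 \<le> (exp (pi / 4))\<^sup>2" "(exp (pi / 4))\<^sup>2 \<le> (2.194::real)\<^sup>2"
    by (auto intro!: power_mono)
  moreover have "(exp (pi / 4))\<^sup>2 = exp (pi / 2)"
    by (simp flip: exp_of_nat_mult)
  ultimately have e: "4.809 \<le> exp (pi / 2)" "exp (pi / 2) \<le> 4.814"
    by (simp_all add: power2_eq_square)
  have s: "sinh (pi / 2) = (exp (pi / 2) - inverse (exp (pi / 2))) / 2"
    by (simp add: sinh_field_def exp_minus)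
  have i: "inverse (4.814::real) \<le> inverse (exp (pi / 2))" "inverse (exp (pi / 2)) \<le> inverse (4.809::real)"
    by (rule le_imp_inverse_le; use e in simp)+
  have sinh: "2.3005 \<le> sinh (pi / 2)" "sinh (pi / 2) \<le> 2.3032"
    using e i unfolding s by auto
  have "2.3005 / 1.5708 \<le> sinh (pi / 2) / (pi / 2)"
    by (rule frac_le; use sinh p in simp)
  hence lower: "1.4645 \<le> sinh (pi / 2) / (pi / 2)"
    by (rule order.trans[rotated]) simp
  have "sinh (pi / 2) / (pi / 2) \<le> 2.3032 / 1.57079"
    by (rule frac_le; use sinh p in simp)
  hence upper: "sinh (pi / 2) / (pi / 2) \<le> 1.4667"
    by (rule order.trans) simp
  have g3: "0.3812 \<le> ln (sinh (pi / 2) / (pi / 2))"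
    by (rule order.trans[OF g1 ln_mono]) (use lower in simp_all)
  have g4: "ln (sinh (pi / 2) / (pi / 2)) \<le> 0.3832"
    by (rule order.trans[OF ln_mono g2]) (use upper in simp_all)
  have f3: "0.45155 \<le> ln (pi / 2)"
    by (rule order.trans[OF f1 ln_mono]) (use p in simp_all)
  have f4: "ln (pi / 2) \<le> 0.4516"
    by (rule order.trans[OF ln_mono f2]) (use p in simp_all)
  define r where "r = ln (pi / 2) / ln (sinh (pi / 2) / (pi / 2))"
  have "0.45155 / 0.3832 \<le> r"
    unfolding r_def
    by (rule frac_le[OF order.trans[OF _ f3] f3 less_le_trans[OF _ g3] g4]) simp_all
  moreover have "r \<le> 0.4516 / 0.3812"
    unfolding r_def by (rule frac_le[OF _ f4 _ g3]) simp_all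
  ultimately show ?thesis
    unfolding r_def[symmetric] by (simp add: abs_if)
qed

theorem theorem2p1:
  shows "strict_mono_on {0<..<pi/2} h \<and>
    is_greatest lower_exponents 1 \<and>
    is_least upper_exponents (ln (pi/2) / ln (sinh (pi/2) / (pi/2))) \<and>
    \<bar>ln (pi/2) / ln (sinh (pi/2) / (pi/2)) - 1.18\<bar> < 0.005"
proof -
  have h_pi: "h (pi / 2) = ln (pi/2) / ln (sinh (pi/2) / (pi/2))"
    by (simp add: h_def)
  have gt: "1 < h x" if "0 < x" "x < pi / 2" for x
    using strict_mono_on_gt_limit_at_right[OF h_strict_mono h_tendsto_one] that by blast
  have lt: "h x < h (pi / 2)" if "0 < x" "x < pi / 2" for x
    using strict_mono_on_less_limit_at_left[OF h_strict_mono h_tendsto_pi_half] that by blast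
  \<comment> \<open>A bound valid at every \<open>x\<close> passes to the limit at 0; that 1 itself
    is admissible is \<open>gt\<close>.\<close>
  have "p \<le> 1" if "\<And>x. 0 < x \<Longrightarrow> x < pi / 2 \<Longrightarrow> p < h x" for p
  proof (rule tendsto_lowerbound[OF h_tendsto_one])
    show "eventually (\<lambda>x. p \<le> h x) (at_right 0)"
      by (rule eventually_mono[OF eventually_at_right_real[of 0 "pi / 2"]])
         (simp, metis greaterThanLessThan_iff less_imp_le that)
  qed auto
  hence "is_greatest lower_exponents 1"
    \<comment> \<open>\<open>powr_one\<close> would erase the exponent 1 before the comparison lemma
      could match.\<close>
    by (auto simp: is_greatest_def lower_exponents_def powr_sinh_quotient_compare gt
             simp del: powr_one)
  moreover have "h (pi / 2) \<le> q" if "\<And>x. 0 < x \<Longrightarrow> x < pi / 2 \<Longrightarrow> h x < q" for q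
  proof (rule tendsto_upperbound[OF h_tendsto_pi_half])
    show "eventually (\<lambda>x. h x \<le> q) (at_left (pi / 2))"
      by (rule eventually_mono[OF eventually_at_left_real[of 0 "pi / 2"]])
         (simp, metis greaterThanLessThan_iff less_imp_le that)
  qed auto
  \<comment> \<open>Membership in \<open>upper_exponents\<close> includes positivity; any interior
    point, here \<open>pi / 4\<close>, yields it.\<close>
  moreover have "h (pi / 2) > 0"
    using gt[of "pi / 4"] lt[of "pi / 4"] by simp
  ultimately show ?thesis
    using h_strict_mono h_pi_half_approx unfolding h_pi[symmetric]
    by (auto simp: is_least_def upper_exponents_def powr_sinh_quotient_compare lt)
qed

end
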